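(* Let $G$ be a connected $P_5$-free chordal bipartite graph that has no Hamiltonian path. Then $G$ is not path-hypohamiltonian.
   Context: Graphs are finite, simple and undirected. A bipartite graph is chordal bipartite if every cycle of length at least six has a chord. $P_5$-free means no induced path on five vertices. A graph $G$ is path-hypohamiltonian if $G$ has no Hamiltonian path and for every vertex $v\in V(G)$ the graph $G-v$ has a Hamiltonian path. *)

theory Defs
  imports "Graph_Theory.Graph_Theory"
begin

text \<open>
  A finite simple undirected graph is an instance of the locale \<^locale>\<open>graph\<close>, a finite,
  symmetric, loop-free digraph without parallel arcs; an undirected edge is a pair of opposite
  arcs. Connectedness is \<^const>\<open>Digraph_Component.connected\<close>, which requires at least one vertex.
\<close>

definition bipartite :: "('a, 'b) pre_digraph \<Rightarrow> bool" where
  "bipartite G \<longleftrightarrow> (\<exists>A B. A \<union> B = verts G \<and> A \<inter> B = {} \<and>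
     (\<forall>e \<in> arcs G. (tail G e \<in> A \<and> head G e \<in> B) \<or> (tail G e \<in> B \<and> head G e \<in> A)))"

text \<open>
  The vertices of a cycle are the tails of its arcs. Either orientation of a cycle edge
  has to be excluded, since a cycle uses only one of the two opposite arcs.
\<close>

definition has_chord :: "('a, 'b) pre_digraph \<Rightarrow> 'b awalk \<Rightarrow> bool" where
  "has_chord G p \<longleftrightarrow> (\<exists>e \<in> arcs G. tail G e \<in> tail G ` set p \<and> head G e \<in> tail G ` set p \<and>
     (tail G e, head G e) \<notin> arc_to_ends G ` set p \<and>
     (head G e, tail G e) \<notin> arc_to_ends G ` set p)"

definition chordal_bipartite :: "('a, 'b) pre_digraph \<Rightarrow> bool" where
  "chordal_bipartite G \<longleftrightarrow> bipartite G \<and>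
     (\<forall>p. pre_digraph.cycle G p \<and> length p \<ge> 6 \<longrightarrow> has_chord G p)"

definition induced_path :: "'a vwalk \<Rightarrow> ('a, 'b) pre_digraph \<Rightarrow> bool" where
  "induced_path p G \<longleftrightarrow> vpath p G \<and>
     (\<forall>u \<in> set p. \<forall>v \<in> set p. (u, v) \<in> arcs_ends G \<longrightarrow>
        (u, v) \<in> set (vwalk_arcs p) \<or> (v, u) \<in> set (vwalk_arcs p))"

definition P5_free :: "('a, 'b) pre_digraph \<Rightarrow> bool" where
  "P5_free G \<longleftrightarrow> \<not> (\<exists>p. induced_path p G \<and> length p = 5)"

definition has_hamiltonian_path :: "('a, 'b) pre_digraph \<Rightarrow> bool" where
  "has_hamiltonian_path G \<longleftrightarrow> (\<exists>p. vpath p G \<and> set p = verts G)"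

definition path_hypohamiltonian :: "('a, 'b) pre_digraph \<Rightarrow> bool" where
  "path_hypohamiltonian G \<longleftrightarrow> \<not> has_hamiltonian_path G \<and>
     (\<forall>v \<in> verts G. has_hamiltonian_path (pre_digraph.del_vert G v))"

end

theory Submission
  imports Defs
begin

text \<open>
  In a connected bipartite $P_5$-free graph the neighbourhoods of the vertices of one part form a
  chain, so a vertex \<open>a\<close> of maximal degree in the part \<open>A\<close> is adjacent to the whole part \<open>B\<close>.
  If every \<open>G - v\<close> has a Hamiltonian path, deleting a vertex of \<open>B\<close> shows
  $|A| \le |B|$. Hence a Hamiltonian path of \<open>G - a\<close> starts in \<open>B\<close>, and prepending \<open>a\<close> yields
  a Hamiltonian path of \<open>G\<close>.
\<close>

text \<open>Consecutive entries lie on opposite sides, so the side of the head is level with the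
  other side or ahead by one. A new head comes from the side opposite to the old head, which was
  level or behind by one; after gaining an entry that side is ahead by one or level.\<close>

lemma card_alternating_list:
  assumes "distinct p" and "p \<noteq> []" and "set p \<subseteq> A \<union> B" and "A \<inter> B = {}"
    and "set (vwalk_arcs p) \<subseteq> A \<times> B \<union> B \<times> A"
  shows "(hd p \<in> A \<longrightarrow> card (B \<inter> set p) \<le> card (A \<inter> set p) \<and>
            card (A \<inter> set p) \<le> Suc (card (B \<inter> set p))) \<and>
         (hd p \<in> B \<longrightarrow> card (A \<inter> set p) \<le> card (B \<inter> set p) \<and>
            card (B \<inter> set p) \<le> Suc (card (A \<inter> set p)))"
  using assms
proof (induction p rule: vwalk_arcs.induct)
  case 1
  then show ?case by simp
next
  case (2 x)
  then show ?case by (auto simp: Int_insert_right)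
next
  case (3 x y xs)
  have IH: "(y \<in> A \<longrightarrow> card (B \<inter> set (y # xs)) \<le> card (A \<inter> set (y # xs)) \<and>
            card (A \<inter> set (y # xs)) \<le> Suc (card (B \<inter> set (y # xs)))) \<and>
         (y \<in> B \<longrightarrow> card (A \<inter> set (y # xs)) \<le> card (B \<inter> set (y # xs)) \<and>
            card (B \<inter> set (y # xs)) \<le> Suc (card (A \<inter> set (y # xs))))"
    using 3 by simp
  have x: "x \<notin> set (y # xs)"
    using "3.prems"(1) by simp
  have ins: "C \<inter> set (x # y # xs) = (if x \<in> C then insert x (C \<inter> set (y # xs)) else C \<inter> set (y # xs))"
    for C by auto
  have fin: "finite (C \<inter> set (y # xs))" "x \<notin> C \<inter> set (y # xs)" for C
    using x by auto
  have card: "card (C \<inter> set (x # y # xs)) =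
      (if x \<in> C then Suc (card (C \<inter> set (y # xs))) else card (C \<inter> set (y # xs)))" for C
    unfolding ins using fin[of C] by (simp del: list.set)
  have "x \<in> A \<and> y \<in> B \<or> x \<in> B \<and> y \<in> A"
    using "3.prems"(5) by auto
  then show ?case
    unfolding card list.sel using IH \<open>A \<inter> B = {}\<close> by (auto simp del: list.set)
qed

text \<open>The two sides are kept as explicit arguments because later lemmas treat them
  differently. The condition is symmetric in \<open>A\<close> and \<open>B\<close>, so a lemma can
  also be applied with the sides exchanged.\<close>

definition parts :: "('a, 'b) pre_digraph \<Rightarrow> 'a set \<Rightarrow> 'a set \<Rightarrow> bool" where
  "parts G A B \<longleftrightarrow> A \<union> B = verts G \<and> A \<inter> B = {} \<and> arcs_ends G \<subseteq> A \<times> B \<union> B \<times> A"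

lemma bipartite_iff_parts: "bipartite G \<longleftrightarrow> (\<exists>A B. parts G A B)"
  unfolding bipartite_def parts_def arcs_ends_conv image_subset_iff by auto

text \<open>Of the six pairs that are not consecutive on the path, four lie within one side and are
  non-adjacent for free. Only \<open>a\<close>, \<open>d\<close> and \<open>b\<close>,
  \<open>e\<close> lie on opposite sides.\<close>

lemma (in graph) induced_path_5I:
  assumes "parts G A B" and "a \<in> A"
    and "a \<rightarrow>\<^bsub>G\<^esub> b" "b \<rightarrow>\<^bsub>G\<^esub> c" "c \<rightarrow>\<^bsub>G\<^esub> d" "d \<rightarrow>\<^bsub>G\<^esub> e"
    and "a \<noteq> c" "\<not> a \<rightarrow>\<^bsub>G\<^esub> d" "\<not> b \<rightarrow>\<^bsub>G\<^esub> e"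
  shows "induced_path [a, b, c, d, e] G"
proof -
  have sym: "v \<rightarrow>\<^bsub>G\<^esub> u" if "u \<rightarrow>\<^bsub>G\<^esub> v" for u v
    using arcs_ends_symmetric[OF sym_arcs that] .
  have arc: "u \<in> A \<and> v \<in> B \<and> u \<notin> B \<and> v \<notin> A \<or> u \<in> B \<and> v \<in> A \<and> u \<notin> A \<and> v \<notin> B" if "u \<rightarrow>\<^bsub>G\<^esub> v" for u v
    using \<open>parts G A B\<close> that unfolding parts_def by blast
  have AB: "a \<in> A" "c \<in> A" "e \<in> A" "b \<notin> A" "d \<notin> A" "b \<in> B" "d \<in> B" "a \<notin> B" "c \<notin> B" "e \<notin> B"
    using \<open>a \<in> A\<close> assms(3-6)[THEN arc] by auto
  have "\<not> u \<rightarrow>\<^bsub>G\<^esub> v" if "u \<in> A \<and> v \<in> A \<or> u \<notin> A \<and> v \<notin> A" for u v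
    using arc that by blast
  then have non: "\<not> a \<rightarrow>\<^bsub>G\<^esub> c" "\<not> c \<rightarrow>\<^bsub>G\<^esub> a" "\<not> a \<rightarrow>\<^bsub>G\<^esub> e" "\<not> e \<rightarrow>\<^bsub>G\<^esub> a" "\<not> c \<rightarrow>\<^bsub>G\<^esub> e" "\<not> e \<rightarrow>\<^bsub>G\<^esub> c" "\<not> b \<rightarrow>\<^bsub>G\<^esub> d" "\<not> d \<rightarrow>\<^bsub>G\<^esub> b"
    "\<not> a \<rightarrow>\<^bsub>G\<^esub> a" "\<not> b \<rightarrow>\<^bsub>G\<^esub> b" "\<not> c \<rightarrow>\<^bsub>G\<^esub> c" "\<not> d \<rightarrow>\<^bsub>G\<^esub> d" "\<not> e \<rightarrow>\<^bsub>G\<^esub> e"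
    using AB by auto
  have "\<not> d \<rightarrow>\<^bsub>G\<^esub> a" "\<not> e \<rightarrow>\<^bsub>G\<^esub> b"
    using assms(8,9) sym by blast+
  note non = non this assms(8,9)
  \<comment> \<open>If \<open>e\<close> were \<open>c\<close> or \<open>a\<close>, it would be a
    neighbour of \<open>b\<close>; if \<open>d\<close> were \<open>b\<close>, it would be a
    neighbour of \<open>a\<close>.\<close>
  have "c \<noteq> e" "a \<noteq> e" "b \<noteq> d"
    using assms(3-9) sym by blast+
  then have "distinct [a, b, c, d, e]"
    using AB \<open>a \<noteq> c\<close> by auto
  moreover have "vwalk [a, b, c, d, e] G"
    using assms(3-6) by (auto simp: vwalk_def adj_in_verts)
  ultimately show ?thesis
    unfolding induced_path_def using non by auto
qed

text \<open>A shortest path of length four would be an induced path on five vertices, so no vertex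
  of \<open>A\<close> is further than two steps from \<open>a\<close>. The clause for
  \<open>B\<close>, a bound of three steps, carries the induction along the walk.\<close>

lemma (in graph) P5_free_common_neighbour:
  assumes "P5_free G" and "parts G A B" and "a \<in> A" and "a \<rightarrow>\<^sup>* x"
  shows "(x \<in> A \<longrightarrow> x = a \<or> (\<exists>b. a \<rightarrow>\<^bsub>G\<^esub> b \<and> b \<rightarrow>\<^bsub>G\<^esub> x)) \<and>
    (x \<in> B \<longrightarrow> (\<exists>y. y \<rightarrow>\<^bsub>G\<^esub> x \<and> (y = a \<or> (\<exists>b. a \<rightarrow>\<^bsub>G\<^esub> b \<and> b \<rightarrow>\<^bsub>G\<^esub> y))))"
  using assms(4)
proof (induction rule: reachable_induct)
  case base
  then show ?case using assms(2,3) unfolding parts_def by auto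
next
  case (step x z)
  have *: "x \<in> A \<and> z \<in> B \<and> z \<notin> A \<or> x \<in> B \<and> z \<in> A \<and> z \<notin> B"
    using assms(2) step.hyps(2) unfolding parts_def by blast
  show ?case
  proof (cases "x \<in> A")
    case True
    then show ?thesis using * step assms(2) unfolding parts_def by blast
  next
    case False
    then obtain y where y: "y \<rightarrow>\<^bsub>G\<^esub> x" "y = a \<or> (\<exists>b. a \<rightarrow>\<^bsub>G\<^esub> b \<and> b \<rightarrow>\<^bsub>G\<^esub> y)"
      using * step.IH by auto
    have "z = a \<or> (\<exists>b. a \<rightarrow>\<^bsub>G\<^esub> b \<and> b \<rightarrow>\<^bsub>G\<^esub> z)"
    proof (rule ccontr)
      assume neg: "\<not> ?thesis"
      then have "y \<noteq> a" using y step.hyps(2) by blast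
      then obtain b where b: "a \<rightarrow>\<^bsub>G\<^esub> b" "b \<rightarrow>\<^bsub>G\<^esub> y" using y by blast
      \<comment> \<open>Either chord, from \<open>a\<close> to \<open>x\<close> or from
        \<open>b\<close> to \<open>z\<close>, would give \<open>a\<close> and \<open>z\<close> a
        common neighbour, against \<open>neg\<close>.\<close>
      have "induced_path [a, b, y, x, z] G"
        using induced_path_5I[OF assms(2,3) b y(1) step.hyps(2)] \<open>y \<noteq> a\<close> neg b(1) step.hyps(2)
        by blast
      then show False
        using assms(1) unfolding P5_free_def by force
    qed
    then show ?thesis using * False by blast
  qed
qed

lemma (in graph) connected_reachable:
  assumes "connected G" and "u \<in> verts G" and "v \<in> verts G"
  shows "u \<rightarrow>\<^sup>* v"
  using symmetric_connected_imp_strongly_connected[OF sym_arcs assms(1)] assms(2,3) by blast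

text \<open>If \<open>a\<close> has maximal degree in \<open>A\<close> but misses \<open>b\<close>,
  then a neighbour \<open>u\<close> of \<open>b\<close> in turn misses some neighbour
  \<open>c\<close> of \<open>a\<close>. A common neighbour of \<open>a\<close> and \<open>u\<close>
  joins these two private edges into an induced path on five vertices.\<close>

lemma (in graph) P5_free_dominating_vertex:
  assumes "connected G" and "P5_free G" and "parts G A B" and "A \<noteq> {}"
    and nbr: "\<And>v. v \<in> B \<Longrightarrow> \<exists>u. u \<rightarrow>\<^bsub>G\<^esub> v"
  obtains a where "a \<in> A" and "\<And>b. b \<in> B \<Longrightarrow> a \<rightarrow>\<^bsub>G\<^esub> b"
proof -
  let ?N = "\<lambda>u. {v. u \<rightarrow>\<^bsub>G\<^esub> v}"
  have fin: "finite (?N u)" for u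
    by (rule finite_subset[OF _ finite_verts]) (auto simp: adj_in_verts)
  have finA: "finite A"
    using assms(3) finite_verts unfolding parts_def by (metis finite_Un)
  have sym: "v \<rightarrow>\<^bsub>G\<^esub> u" if "u \<rightarrow>\<^bsub>G\<^esub> v" for u v
    using arcs_ends_symmetric[OF sym_arcs that] .
  obtain a where a: "a \<in> A" and max: "\<And>u. u \<in> A \<Longrightarrow> card (?N u) \<le> card (?N a)"
  proof -
    have "Max ((\<lambda>u. card (?N u)) ` A) \<in> (\<lambda>u. card (?N u)) ` A"
      using finA assms(4) by (intro Max_in) auto
    then obtain a where "a \<in> A" "card (?N a) = Max ((\<lambda>u. card (?N u)) ` A)"
      by auto
    then show ?thesis using that finA by auto
  qed
  have "a \<rightarrow>\<^bsub>G\<^esub> b" if "b \<in> B" for b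
  proof (rule ccontr)
    assume ab: "\<not> a \<rightarrow>\<^bsub>G\<^esub> b"
    obtain u where u: "u \<rightarrow>\<^bsub>G\<^esub> b" using nbr[OF \<open>b \<in> B\<close>] by blast
    have "u \<in> A" using u \<open>b \<in> B\<close> assms(3) unfolding parts_def by blast
    \<comment> \<open>A proper inclusion would give \<open>u\<close> a larger degree than
      \<open>a\<close>. Since \<open>b\<close> lies in \<open>?N u\<close> but not in
      \<open>?N a\<close>, even a plain inclusion is excluded, which yields
      \<open>c\<close>.\<close>
    have "\<not> ?N a \<subset> ?N u"
      using max[OF \<open>u \<in> A\<close>] psubset_card_mono[OF fin[of u], of "?N a"] by linarith
    then obtain c where c: "a \<rightarrow>\<^bsub>G\<^esub> c" "\<not> u \<rightarrow>\<^bsub>G\<^esub> c"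
      using u ab by blast
    have "u \<noteq> a" using u ab by blast
    moreover have "a \<rightarrow>\<^sup>* u"
      using connected_reachable[OF assms(1)] a \<open>u \<in> A\<close> assms(3) unfolding parts_def by blast
    ultimately obtain d where d: "a \<rightarrow>\<^bsub>G\<^esub> d" "d \<rightarrow>\<^bsub>G\<^esub> u"
      using P5_free_common_neighbour[OF assms(2,3) a] \<open>u \<in> A\<close> by blast
    \<comment> \<open>This path starts in \<open>B\<close>, hence the exchanged sides. The forbidden
      chords are \<open>b\<close> to \<open>a\<close> and \<open>u\<close> to
      \<open>c\<close>.\<close>
    have "induced_path [b, u, d, a, c] G"
      using induced_path_5I[of B A b u d a c] assms(3) \<open>b \<in> B\<close> u sym d c ab
      unfolding parts_def by blast
    then show False
      using assms(2) unfolding P5_free_def by force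
  qed
  then show ?thesis using that a by blast
qed

lemma vpath_del_vert:
  assumes "vpath p (pre_digraph.del_vert G v)"
  shows "vpath p G"
  using assms
  unfolding vpath_def vwalk_def arcs_ends_conv pre_digraph.del_vert_simps by blast

lemma (in graph) hamiltonian_path_del_dominating:
  assumes "parts G A B" and "a \<in> A" and dom: "\<And>b. b \<in> B \<Longrightarrow> a \<rightarrow>\<^bsub>G\<^esub> b"
    and "b \<in> B" and ham: "\<And>v. v \<in> verts G \<Longrightarrow> has_hamiltonian_path (del_vert v)"
  shows "has_hamiltonian_path G"
proof -
  have AB: "A \<union> B = verts G" "A \<inter> B = {}" "arcs_ends G \<subseteq> A \<times> B \<union> B \<times> A"
    using assms(1) unfolding parts_def by auto
  have fin: "finite A" "finite B"
    using AB(1) finite_verts by (metis finite_Un)+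
  have del: "\<exists>p. vpath p G \<and> set p = verts G - {v}" if "v \<in> verts G" for v
    using ham[OF that] vpath_del_vert[of _ G v]
    unfolding has_hamiltonian_path_def verts_del_vert by metis
  have alt: "distinct p \<and> p \<noteq> [] \<and> set p \<subseteq> A \<union> B \<and> set (vwalk_arcs p) \<subseteq> A \<times> B \<union> B \<times> A"
    if "vpath p G" for p
    using that AB unfolding vpath_def vwalk_def by auto
  obtain q where q: "vpath q G" "set q = verts G - {b}"
    using del AB(1) \<open>b \<in> B\<close> by blast
  have "A \<inter> set q = A" "B \<inter> set q = B - {b}"
    using q(2) AB \<open>b \<in> B\<close> by auto
  moreover have "hd q \<in> A \<or> hd q \<in> B"
    using alt[OF q(1)] by (meson UnE hd_in_set subsetD)
  \<comment> \<open>Whichever side \<open>q\<close> starts on, \<open>A\<close> exceeds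
    \<open>B - {b}\<close> by at most one.\<close>
  ultimately have "card A \<le> Suc (card (B - {b}))"
    using card_alternating_list[of q A B] alt[OF q(1)] AB(2) by auto
  then have le: "card A \<le> card B"
    using card.remove[OF fin(2) \<open>b \<in> B\<close>] by simp
  obtain p where p: "vpath p G" "set p = verts G - {a}"
    using del AB(1) \<open>a \<in> A\<close> by blast
  have "A \<inter> set p = A - {a}" "B \<inter> set p = B"
    using p(2) AB \<open>a \<in> A\<close> by auto
  moreover have "card A = Suc (card (A - {a}))"
    using card.remove[OF fin(1) \<open>a \<in> A\<close>] .
  \<comment> \<open>A start in \<open>A\<close> would force \<open>card B\<close> to be at most
    \<open>card (A - {a})\<close>, which is less than \<open>card A\<close> and so less than
    \<open>card B\<close>.\<close>
  ultimately have "hd p \<notin> A"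
    using card_alternating_list[of p A B] alt[OF p(1)] AB(2) le by auto
  then have "hd p \<in> B"
    using alt[OF p(1)] by (meson UnE hd_in_set subsetD)
  then have "vpath (a # p) G"
    using p dom AB(1) \<open>a \<in> A\<close> unfolding vpath_def by (auto intro!: vwalk_consI)
  moreover have "set (a # p) = verts G"
    using p(2) AB(1) \<open>a \<in> A\<close> by auto
  ultimately show ?thesis
    unfolding has_hamiltonian_path_def by blast
qed

text \<open>A vertex without neighbours reaches only itself, so by connectedness it is the whole
  graph, and the path consisting of it alone is Hamiltonian.\<close>

lemma (in graph) connected_non_hamiltonian_neighbour:
  assumes "connected G" and "\<not> has_hamiltonian_path G" and "v \<in> verts G"
  shows "\<exists>u. v \<rightarrow>\<^bsub>G\<^esub> u"
proof (rule ccontr)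
  assume neg: "\<nexists>u. v \<rightarrow>\<^bsub>G\<^esub> u"
  have "w = v" if "w \<in> verts G" for w
    using connected_reachable[OF assms(1,3) that] neg
    by (auto simp: reachable_conv'[OF assms(3)] elim: converse_rtranclE)
  then have "verts G = {v}" using assms(3) by blast
  then have "has_hamiltonian_path G"
    unfolding has_hamiltonian_path_def using vpath_self[OF assms(3)] by force
  then show False using assms(2) by blast
qed

theorem theorem11:
  fixes G :: "('a, 'b) pre_digraph"
  assumes "graph G"
    and "Digraph_Component.connected G"
    and "P5_free G"
    and "chordal_bipartite G"
    and "\<not> has_hamiltonian_path G"
  shows "\<not> path_hypohamiltonian G"
proof
  assume hypo: "path_hypohamiltonian G"
  interpret graph G by fact
  obtain A B where parts: "parts G A B"
    using assms(4) unfolding chordal_bipartite_def bipartite_iff_parts by blast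
  have nbr: "\<exists>u. v \<rightarrow>\<^bsub>G\<^esub> u" if "v \<in> verts G" for v
    using connected_non_hamiltonian_neighbour[OF assms(2,5) that] .
  have "verts G \<noteq> {}"
    using assms(2) unfolding connected_def strongly_connected_def by simp
  \<comment> \<open>One edge makes both sides non-empty: \<open>A\<close> must contain the
    dominating vertex and \<open>B\<close> a vertex to delete for the count.\<close>
  then obtain u v where uv: "u \<rightarrow>\<^bsub>G\<^esub> v" using nbr by blast
  then have "A \<noteq> {}" "B \<noteq> {}"
    using parts unfolding parts_def by blast+
  have "\<exists>u. u \<rightarrow>\<^bsub>G\<^esub> v" if "v \<in> B" for v
    using nbr[of v] that parts arcs_ends_symmetric[OF sym_arcs] unfolding parts_def by blast
  then obtain a where "a \<in> A" "\<And>b. b \<in> B \<Longrightarrow> a \<rightarrow>\<^bsub>G\<^esub> b"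
    using P5_free_dominating_vertex[OF assms(2,3) parts \<open>A \<noteq> {}\<close>] by blast
  then have "has_hamiltonian_path G"
    using hamiltonian_path_del_dominating[OF parts] \<open>B \<noteq> {}\<close> hypo
    unfolding path_hypohamiltonian_def by blast
  then show False using assms(5) by blast
qed

end
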